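(* For a four-dimensional rotating spacetime of separable (Carter) type with radial functions $f_1(r),f_2(r)$ and angular functions $y_1(x),y_2(x)$, consider the radial pole-skipping data $E^{(r)}_n(\lambda^l)$ and angular pole-skipping data $E^{(a)}_n(\lambda^l)$ of a massless scalar, both evaluated at $(\mathfrak w,k)=(\mathfrak w_n,k_n)$ (all defined in the context), for $n=1,2$. Put $f_{\alpha j}=f_\alpha^{(j)}(r_h)$, $y_{\alpha j}=y_\alpha^{(j)}(x_0)$, and assume $a\ne0$ and $\mathfrak w_1+k_1\Omega_H\neq0$. Then the first and second derivatives of the four metric functions are $$f_{11}=\frac{2ia\,\mathfrak w_1}{\Omega_H},\quad f_{21}=\frac{iE^{(r)}_1(\lambda)}{\mathfrak w_1+k_1\Omega_H},\quad y_{11}=2k_1,\quad y_{21}=-\frac{E^{(a)}_1(\lambda)}{\mathfrak w_1+k_1\Omega_H},$$ $$f_{12}=E^{(r)}_2(\lambda)-8E^{(r)}_1(\lambda),\qquad y_{12}=8E^{(a)}_1(\lambda)-E^{(a)}_2(\lambda),$$ $$f_{22}=\frac{\Omega_H}{4a\,\mathfrak w_1(\mathfrak w_1+k_1\Omega_H)}\Big(E^{(r)}_2(\lambda^2)-2E^{(r)}_2(\lambda)E^{(r)}_1(\lambda)+4E^{(r)}_1(\lambda)^2\Big),$$ $$y_{22}=\frac{1}{4k_1(\mathfrak w_1+k_1\Omega_H)}\Big(E^{(a)}_2(\lambda^2)-2E^{(a)}_2(\lambda)E^{(a)}_1(\lambda)+4E^{(a)}_1(\lambda)^2\Big).$$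
   Context: Metric: $ds^2=-\frac{f_1(r)}{Z}(dt-y_2(x)d\varphi)^2+\frac{y_1(x)}{Z}(a\,dt-f_2(r)d\varphi)^2+\frac{Z}{f_1(r)}dr^2+\frac{Z}{y_1(x)}dx^2$ with $Z=f_2(r)-a\,y_2(x)$ and rotation parameter $a$. Horizon at $r=r_h$: $f_1(r_h)=0$; Hawking temperature $T=\frac{f_1'(r_h)}{4\pi f_2(r_h)}>0$, horizon angular velocity $\Omega_H=a/f_2(r_h)$. Rotation axis at $x=x_0$: $y_1(x_0)=y_2(x_0)=0$, $y_1'(x_0)\ne0$. The functions $f_\alpha$ are analytic near $r_h$ and $y_\alpha$ near $x_0$. A massless scalar $\Phi=e^{-i\omega t+ik\varphi}\Theta(x)\psi(r)$ separates, with separation constant $\lambda$ (treated as a complex variable), into $A\psi''+B\psi'+C\psi=0$ with $A=f_1^2$, $B=f_1f_1'$, $C=(ak-\omega f_2)^2-\lambda f_1$ (radial), and $\tilde A\Theta''+\tilde B\Theta'+\tilde C\Theta=0$ with $\tilde A=y_1^2$, $\tilde B=y_1y_1'$, $\tilde C=-(k-\omega y_2)^2+\lambda y_1$ (angular). Let $A_j,B_j,C_j$ be the coefficients of $(r-r_h)^j$ and $\tilde A_j,\tilde B_j,\tilde C_j$ those of $(x-x_0)^j$ (zero for $j<0$). For an exponent $\rho$ define $M_{KS}=A_{K-S+3}(\rho+S-1)(\rho+S-2)+B_{K-S+2}(\rho+S-1)+C_{K-S+1}$, the coefficient of $\phi_{S-1}$ at order $(r-r_h)^{\rho+K}$ when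 $\psi=(r-r_h)^\rho\sum_j\phi_j(r-r_h)^j$ is inserted; define $\tilde M_{KS}$ likewise for the angular equation. Put $\mathfrak w=\omega-k\Omega_H$, $\mathfrak w_n=-2\pi iTn$, $k_n=n\,y_1'(x_0)/2$, and $\omega_n=\mathfrak w_n+k_n\Omega_H$. Both sectors are evaluated at $\omega=\omega_n$, $k=k_n$. Radial exponent: $\rho=-i\mathfrak w/(4\pi T)=-n/2$. Angular exponent: $\rho=-k/y_1'(x_0)=-n/2$. Then $\det(M_{KS})_{1\le K,S\le n}$ and $\det(\tilde M_{KS})_{1\le K,S\le n}$ are polynomials of degree $n$ in $\lambda$; their roots (with multiplicity) are the radial and angular pole-skipping values at order $n$, and $E^{(r)}_n(\lambda^l)$, $E^{(a)}_n(\lambda^l)$ are the degree-$l$ elementary symmetric polynomials of the radial and angular roots respectively. *)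

theory Defs
  imports
    Complex_Main
    "HOL-Analysis.Derivative"
    "HOL-Computational_Algebra.Fundamental_Theorem_Algebra"
    "Jordan_Normal_Form.Determinant"
begin

text \<open>
  Expansions in the real variables \<open>r\<close> and \<open>x\<close>. The coefficients \<open>C\<close> of the separated equations
  are complex valued because \<open>\<omega>\<close> and the separation constant are complex, so the value type is kept general; the
  library's \<open>has_fps_expansion\<close> needs equal argument and value types.
\<close>

definition has_power_series_at :: "(real \<Rightarrow> 'a::real_normed_vector) \<Rightarrow> real \<Rightarrow> (nat \<Rightarrow> 'a) \<Rightarrow> bool" where
  "has_power_series_at g z c \<longleftrightarrow>
     (\<exists>d>0. \<forall>h. \<bar>h\<bar> < d \<longrightarrow> (\<lambda>j. h ^ j *\<^sub>R c j) sums g (z + h))"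

definition real_analytic_at :: "(real \<Rightarrow> 'a::real_normed_vector) \<Rightarrow> real \<Rightarrow> bool" where
  "real_analytic_at g z \<longleftrightarrow> (\<exists>c. has_power_series_at g z c)"

definition series_coeff :: "(real \<Rightarrow> 'a::real_normed_vector) \<Rightarrow> real \<Rightarrow> int \<Rightarrow> 'a" where
  "series_coeff g z j = (if j < 0 then 0 else (THE c. has_power_series_at g z c) (nat j))"

text \<open>
  Elementary symmetric polynomial of degree \<open>l\<close> in the elements of a multiset. The index set
  contains one pair \<open>(z, i)\<close> for every occurrence of \<open>z\<close>, so repeated elements are treated as
  separate variables.
\<close>

definition elem_sym :: "nat \<Rightarrow> complex multiset \<Rightarrow> complex" where
  "elem_sym l R = (\<Sum>I | I \<subseteq> {(z, i). i < count R z} \<and> card I = l. \<Prod>(z, i)\<in>I. z)"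

text \<open>
  A separable spacetime, with the horizon and axis positions, given by the data in the metric
  \[ ds^2 = -\frac{f_1(r)}{Z}(dt - y_2(x)\,d\varphi)^2 + \frac{y_1(x)}{Z}(a\,dt - f_2(r)\,d\varphi)^2
      + \frac{Z}{f_1(r)}dr^2 + \frac{Z}{y_1(x)}dx^2, \qquad Z = f_2(r) - a\,y_2(x). \]
\<close>

record carter_spacetime =
  f\<^sub>1 :: "real \<Rightarrow> real"
  f\<^sub>2 :: "real \<Rightarrow> real"
  y\<^sub>1 :: "real \<Rightarrow> real"
  y\<^sub>2 :: "real \<Rightarrow> real"
  rot :: real
  r\<^sub>h :: real
  x\<^sub>0 :: real

definition hawking_temp :: "carter_spacetime \<Rightarrow> real" where
  "hawking_temp G = deriv (f\<^sub>1 G) (r\<^sub>h G) / (4 * pi * f\<^sub>2 G (r\<^sub>h G))"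

definition Omega_H :: "carter_spacetime \<Rightarrow> real" where
  "Omega_H G = rot G / f\<^sub>2 G (r\<^sub>h G)"

text \<open>
  The massless scalar \<open>\<Phi> = exp (- \<i> \<omega> t + \<i> k \<phi>) \<Theta>(x) \<psi>(r)\<close> obeys
  \<open>A \<psi>'' + B \<psi>' + C \<psi> = 0\<close> (radial) and the analogous angular equation for \<open>\<Theta>\<close>.
\<close>

definition A_rad :: "carter_spacetime \<Rightarrow> real \<Rightarrow> complex" where
  "A_rad G r = of_real ((f\<^sub>1 G r)\<^sup>2)"

definition B_rad :: "carter_spacetime \<Rightarrow> real \<Rightarrow> complex" where
  "B_rad G r = of_real (f\<^sub>1 G r * deriv (f\<^sub>1 G) r)"

definition C_rad :: "carter_spacetime \<Rightarrow> complex \<Rightarrow> complex \<Rightarrow> complex \<Rightarrow> real \<Rightarrow> complex" where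
  "C_rad G \<omega> k lam r =
     (of_real (rot G) * k - \<omega> * of_real (f\<^sub>2 G r))\<^sup>2 - lam * of_real (f\<^sub>1 G r)"

definition A_ang :: "carter_spacetime \<Rightarrow> real \<Rightarrow> complex" where
  "A_ang G x = of_real ((y\<^sub>1 G x)\<^sup>2)"

definition B_ang :: "carter_spacetime \<Rightarrow> real \<Rightarrow> complex" where
  "B_ang G x = of_real (y\<^sub>1 G x * deriv (y\<^sub>1 G) x)"

definition C_ang :: "carter_spacetime \<Rightarrow> complex \<Rightarrow> complex \<Rightarrow> complex \<Rightarrow> real \<Rightarrow> complex" where
  "C_ang G \<omega> k lam x =
     - (k - \<omega> * of_real (y\<^sub>2 G x))\<^sup>2 + lam * of_real (y\<^sub>1 G x)"

text \<open>
  Inserting \<open>(r - z)\<^sup>\<rho> (\<Sum>j. \<phi>\<^sub>j (r - z)\<^sup>j)\<close> into \<open>A \<psi>'' + B \<psi>' + C \<psi> = 0\<close>, the coefficient of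
  \<open>\<phi>\<close> with index \<open>S - 1\<close> at order \<open>\<rho> + K\<close>; both \<open>K\<close> and \<open>S\<close> start at 1.
\<close>

definition frobenius_entry ::
  "(real \<Rightarrow> complex) \<Rightarrow> (real \<Rightarrow> complex) \<Rightarrow> (real \<Rightarrow> complex) \<Rightarrow> real \<Rightarrow> complex \<Rightarrow> nat \<Rightarrow> nat \<Rightarrow> complex" where
  "frobenius_entry A B C z \<rho> K S =
     series_coeff A z (int K - int S + 3) * (\<rho> + of_nat S - 1) * (\<rho> + of_nat S - 2)
   + series_coeff B z (int K - int S + 2) * (\<rho> + of_nat S - 1)
   + series_coeff C z (int K - int S + 1)"

definition w_n :: "carter_spacetime \<Rightarrow> nat \<Rightarrow> complex" where
  "w_n G n = - 2 * of_real pi * \<i> * of_real (hawking_temp G) * of_nat n"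

definition k_n :: "carter_spacetime \<Rightarrow> nat \<Rightarrow> complex" where
  "k_n G n = of_nat n * of_real (deriv (y\<^sub>1 G) (x\<^sub>0 G)) / 2"

definition omega_n :: "carter_spacetime \<Rightarrow> nat \<Rightarrow> complex" where
  "omega_n G n = w_n G n + k_n G n * of_real (Omega_H G)"

definition rho_rad :: "carter_spacetime \<Rightarrow> complex \<Rightarrow> complex \<Rightarrow> complex" where
  "rho_rad G \<omega> k =
     - \<i> * (\<omega> - k * of_real (Omega_H G)) / (4 * of_real pi * of_real (hawking_temp G))"

definition rho_ang :: "carter_spacetime \<Rightarrow> complex \<Rightarrow> complex" where
  "rho_ang G k = - k / of_real (deriv (y\<^sub>1 G) (x\<^sub>0 G))"

definition M_rad :: "carter_spacetime \<Rightarrow> complex \<Rightarrow> complex \<Rightarrow> complex \<Rightarrow> nat \<Rightarrow> nat \<Rightarrow> complex" where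
  "M_rad G \<omega> k lam =
     frobenius_entry (A_rad G) (B_rad G) (C_rad G \<omega> k lam) (r\<^sub>h G) (rho_rad G \<omega> k)"

definition M_ang :: "carter_spacetime \<Rightarrow> complex \<Rightarrow> complex \<Rightarrow> complex \<Rightarrow> nat \<Rightarrow> nat \<Rightarrow> complex" where
  "M_ang G \<omega> k lam =
     frobenius_entry (A_ang G) (B_ang G) (C_ang G \<omega> k lam) (x\<^sub>0 G) (rho_ang G k)"

text \<open>Matrices are indexed from 0 in the library and from 1 in \<open>M\<close>.\<close>

definition leading_minor :: "(nat \<Rightarrow> nat \<Rightarrow> complex) \<Rightarrow> nat \<Rightarrow> complex" where
  "leading_minor M n = Determinant.det (Matrix.mat n n (\<lambda>(i, j). M (Suc i) (Suc j)))"

definition poly_of_fun :: "(complex \<Rightarrow> complex) \<Rightarrow> complex poly" where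
  "poly_of_fun D = (THE p. \<forall>lam. poly p lam = D lam)"

definition roots_rad :: "carter_spacetime \<Rightarrow> nat \<Rightarrow> complex multiset" where
  "roots_rad G n =
     proots (poly_of_fun (\<lambda>lam. leading_minor (M_rad G (omega_n G n) (k_n G n) lam) n))"

definition roots_ang :: "carter_spacetime \<Rightarrow> nat \<Rightarrow> complex multiset" where
  "roots_ang G n =
     proots (poly_of_fun (\<lambda>lam. leading_minor (M_ang G (omega_n G n) (k_n G n) lam) n))"

definition E_rad :: "carter_spacetime \<Rightarrow> nat \<Rightarrow> nat \<Rightarrow> complex" where
  "E_rad G n l = elem_sym l (roots_rad G n)"

definition E_ang :: "carter_spacetime \<Rightarrow> nat \<Rightarrow> nat \<Rightarrow> complex" where
  "E_ang G n l = elem_sym l (roots_ang G n)"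

end

theory Submission
  imports Defs "HOL-Analysis.FPS_Convergence"
begin

text \<open>
  Both separated equations have the form \<open>A = u\<^sup>2\<close>, \<open>B = u u'\<close>, \<open>C = \<sigma> ((\<kappa> - \<omega> v)\<^sup>2 - \<lambda> u)\<close> with
  \<open>u z = 0\<close> and \<open>\<sigma> = \<plusminus>1\<close>, and the exponent \<open>\<rho> = - n / 2\<close> makes the \<open>A\<close> and \<open>B\<close> contributions to
  \<open>M\<^sub>1\<^sub>1\<close> at \<open>n = 1\<close> and to \<open>M\<^sub>2\<^sub>1\<close>, \<open>M\<^sub>2\<^sub>2\<close> at \<open>n = 2\<close> cancel. The determinants for \<open>n = 1, 2\<close> are then
  explicit polynomials in \<open>\<lambda>\<close> whose coefficients involve only the first two derivatives of \<open>u\<close> and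
  \<open>v\<close>. By Vieta's formulas these coefficients are the elementary symmetric polynomials of the
  roots, and the resulting triangular system is solved for the derivatives.
\<close>

section \<open>Power series at a real point\<close>

lemma fps_nth_eq_higher_deriv:
  fixes f :: "'a::{banach,real_normed_field} \<Rightarrow> 'a"
  assumes "f has_fps_expansion F"
  shows "fps_nth F n = (deriv ^^ n) f 0 / fact n"
proof -
  have "(deriv ^^ n) f has_fps_expansion (fps_deriv ^^ n) F"
    by (induction n) (simp_all add: assms has_fps_expansion_deriv)
  hence "(deriv ^^ n) f 0 = fps_nth ((fps_deriv ^^ n) F) 0"
    by (auto simp: has_fps_expansion_def eval_fps_at_0 dest: eventually_nhds_x_imp_x)
  thus ?thesis
    by (simp add: fps_0th_higher_deriv)
qed

text \<open>Passing to the shifted function makes products, derivatives and uniqueness available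
  from formal power series.\<close>

lemma has_power_series_at_iff_has_fps_expansion:
  fixes g :: "real \<Rightarrow> real"
  shows "has_power_series_at g z c \<longleftrightarrow> (\<lambda>h. g (z + h)) has_fps_expansion Abs_fps c"
proof
  assume "has_power_series_at g z c"
  then obtain d where d: "d > 0" "\<And>h. \<bar>h\<bar> < d \<Longrightarrow> (\<lambda>j. h ^ j *\<^sub>R c j) sums g (z + h)"
    unfolding has_power_series_at_def by blast
  have sums: "(\<lambda>j. c j * h ^ j) sums g (z + h)" if "\<bar>h\<bar> < d" for h
    using d(2)[OF that] by (simp add: mult.commute)
  \<comment> \<open>Convergence at the interior point \<open>d / 2\<close> makes the radius of
    convergence positive.\<close>
  have "summable (\<lambda>j. c j * (d / 2) ^ j)"
    using sums[of "d / 2"] d(1) by (auto simp: sums_iff)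
  hence "fps_conv_radius (Abs_fps c) \<ge> ereal (norm (d / 2))"
    unfolding fps_conv_radius_def by (intro conv_radius_geI) simp
  moreover have "ereal (norm (d / 2)) > 0"
    using d(1) by simp
  ultimately have "fps_conv_radius (Abs_fps c) > 0"
    by (rule less_le_trans[rotated])
  moreover have "eventually (\<lambda>h. h \<in> ball 0 d) (nhds (0::real))"
    using d(1) by (intro eventually_nhds_in_open) auto
  hence "eventually (\<lambda>h. eval_fps (Abs_fps c) h = g (z + h)) (nhds 0)"
    by eventually_elim (use sums in \<open>auto simp: eval_fps_def sums_iff\<close>)
  ultimately show "(\<lambda>h. g (z + h)) has_fps_expansion Abs_fps c"
    unfolding has_fps_expansion_def by blast
next
  assume *: "(\<lambda>h. g (z + h)) has_fps_expansion Abs_fps c"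
  hence "eventually (\<lambda>h. h \<in> eball 0 (fps_conv_radius (Abs_fps c))) (nhds 0)"
    by (intro eventually_nhds_in_open) (auto simp: has_fps_expansion_def zero_ereal_def)
  moreover from * have "eventually (\<lambda>h. eval_fps (Abs_fps c) h = g (z + h)) (nhds 0)"
    by (auto simp: has_fps_expansion_def)
  ultimately have "eventually (\<lambda>h. (\<lambda>j. h ^ j *\<^sub>R c j) sums g (z + h)) (nhds 0)"
  proof eventually_elim
    case (elim h)
    thus ?case
      using sums_eval_fps[of h "Abs_fps c"] by (simp add: mult.commute)
  qed
  thus "has_power_series_at g z c"
    unfolding eventually_nhds_metric has_power_series_at_def by simp
qed

lemma has_power_series_at_real_unique:
  fixes g :: "real \<Rightarrow> real"
  assumes "has_power_series_at g z b" "has_power_series_at g z c"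
  shows "b = c"
proof
  fix n
  show "b n = c n"
    using assms[unfolded has_power_series_at_iff_has_fps_expansion, THEN fps_nth_eq_higher_deriv, of n]
    by simp
qed

text \<open>Bounded linear maps commute with convergent sums and real scaling. The instances needed
  are \<open>of_real\<close>, \<open>Re\<close>, \<open>Im\<close> and multiplication by a complex
  constant.\<close>

lemma has_power_series_at_bounded_linear:
  assumes "bounded_linear L" "has_power_series_at g z c"
  shows "has_power_series_at (\<lambda>x. L (g x)) z (\<lambda>j. L (c j))"
proof -
  have "(\<lambda>j. h ^ j *\<^sub>R L (c j)) sums L (g (z + h))" if "(\<lambda>j. h ^ j *\<^sub>R c j) sums g (z + h)" for h
    using bounded_linear.sums[OF assms(1) that]
    by (simp add: linear_cmul[OF bounded_linear.linear[OF assms(1)]])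
  with assms(2) show ?thesis
    unfolding has_power_series_at_def by blast
qed

lemma has_power_series_at_add:
  assumes "has_power_series_at f z b" "has_power_series_at g z c"
  shows "has_power_series_at (\<lambda>x. f x + g x) z (\<lambda>j. b j + c j)"
proof -
  obtain d where d: "d > 0" "\<And>h. \<bar>h\<bar> < d \<Longrightarrow> (\<lambda>j. h ^ j *\<^sub>R b j) sums f (z + h)"
    using assms(1) unfolding has_power_series_at_def by blast
  obtain e where e: "e > 0" "\<And>h. \<bar>h\<bar> < e \<Longrightarrow> (\<lambda>j. h ^ j *\<^sub>R c j) sums g (z + h)"
    using assms(2) unfolding has_power_series_at_def by blast
  show ?thesis
    unfolding has_power_series_at_def
    using d e by (intro exI[of _ "min d e"]) (auto simp: scaleR_add_right intro!: sums_add)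
qed

lemma has_power_series_at_of_real:
  assumes "(\<lambda>h. g (z + h)) has_fps_expansion F"
  shows "has_power_series_at (\<lambda>x. complex_of_real (g x)) z (\<lambda>j. of_real (fps_nth F j))"
  using assms
  by (intro has_power_series_at_bounded_linear[OF bounded_linear_of_real])
     (simp add: has_power_series_at_iff_has_fps_expansion fps_nth_inverse)

text \<open>Argument and value types differ here, so the real case is applied to real and imaginary
  parts separately.\<close>

lemma has_power_series_at_complex_unique:
  fixes g :: "real \<Rightarrow> complex"
  assumes "has_power_series_at g z b" "has_power_series_at g z c"
  shows "b = c"
proof
  fix n
  have "(\<lambda>j. Re (b j)) = (\<lambda>j. Re (c j))" "(\<lambda>j. Im (b j)) = (\<lambda>j. Im (c j))"
    by (rule has_power_series_at_real_unique;
        rule has_power_series_at_bounded_linear[OF bounded_linear_Re]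
             has_power_series_at_bounded_linear[OF bounded_linear_Im], fact assms)+
  thus "b n = c n"
    by (simp add: fun_eq_iff complex_eq_iff)
qed

lemma series_coeff_eq:
  fixes g :: "real \<Rightarrow> complex"
  assumes "has_power_series_at g z c"
  shows "series_coeff g z (int j) = c j"
proof -
  have "(THE c. has_power_series_at g z c) = c"
    using assms by (blast intro: has_power_series_at_complex_unique)
  thus ?thesis
    by (simp add: series_coeff_def)
qed

section \<open>Taylor coefficients and the matrix entries\<close>

definition taylor_fps :: "(real \<Rightarrow> real) \<Rightarrow> real \<Rightarrow> real fps" where
  "taylor_fps g z = Abs_fps (\<lambda>n. (deriv ^^ n) g z / fact n)"

lemma has_fps_expansion_taylor_fps:
  assumes "real_analytic_at g z"
  shows "(\<lambda>h. g (z + h)) has_fps_expansion taylor_fps g z"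
proof -
  obtain c where c: "(\<lambda>h. g (z + h)) has_fps_expansion Abs_fps c"
    using assms unfolding real_analytic_at_def has_power_series_at_iff_has_fps_expansion by blast
  have "Abs_fps c = taylor_fps g z"
    unfolding fps_eq_iff fps_nth_eq_higher_deriv[OF c] taylor_fps_def
    by (simp add: higher_deriv_shift_0[of _ g z] o_def)
  with c show ?thesis
    by simp
qed

text \<open>
  The sign \<open>\<sigma>\<close> is \<open>1\<close> for the radial equation and \<open>-1\<close> for the angular one. Since \<open>B\<close> is half the
  derivative of \<open>A\<close>, its coefficients can be eliminated.
\<close>

lemma frobenius_entry_eq:
  fixes u v :: "real \<Rightarrow> real" and \<sigma> \<kappa> \<omega> lam \<rho> :: complex
  assumes u: "real_analytic_at u z" and v: "real_analytic_at v z" and "S \<le> Suc K"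
  defines "U \<equiv> taylor_fps u z" and "V \<equiv> taylor_fps v z"
  defines "m \<equiv> Suc K - S" and "s \<equiv> \<rho> + of_nat S - 1"
  shows "frobenius_entry (\<lambda>x. of_real ((u x)\<^sup>2)) (\<lambda>x. of_real (u x * deriv u x))
           (\<lambda>x. \<sigma> * ((\<kappa> - \<omega> * of_real (v x))\<^sup>2 - lam * of_real (u x))) z \<rho> K S =
         of_real (fps_nth (U * U) (m + 2)) * s * (s + of_nat m / 2)
         + \<sigma> * ((if m = 0 then \<kappa>\<^sup>2 else 0) - 2 * \<kappa> * \<omega> * of_real (fps_nth V m)
                + \<omega>\<^sup>2 * of_real (fps_nth (V * V) m) - lam * of_real (fps_nth U m))"
    (is "frobenius_entry ?A ?B ?C z \<rho> K S = _")
proof -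
  have eU: "(\<lambda>h. u (z + h)) has_fps_expansion U" and eV: "(\<lambda>h. v (z + h)) has_fps_expansion V"
    unfolding U_def V_def using u v by (simp_all add: has_fps_expansion_taylor_fps)
  have eUU: "(\<lambda>h. (u (z + h))\<^sup>2) has_fps_expansion U * U"
    unfolding power2_eq_square by (intro has_fps_expansion_mult eU)
  have eVV: "(\<lambda>h. (v (z + h))\<^sup>2) has_fps_expansion V * V"
    unfolding power2_eq_square by (intro has_fps_expansion_mult eV)
  have dU: "(\<lambda>h. deriv u (z + h)) = deriv (\<lambda>h. u (z + h))"
    by (rule ext, subst (1 2) deriv_shift_0) (simp add: o_def add_ac)
  have "(\<lambda>h. u (z + h) * deriv u (z + h)) has_fps_expansion U * fps_deriv U"
    using has_fps_expansion_mult[OF eU has_fps_expansion_deriv[OF eU]] by (simp flip: dU)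
  from has_power_series_at_of_real[where g = "\<lambda>x. u x * deriv u x", OF this]
  have B: "series_coeff ?B z (int j) = of_real (fps_nth (U * fps_deriv U) j)" for j
    by (rule series_coeff_eq)
  have A: "series_coeff ?A z (int j) = of_real (fps_nth (U * U) j)" for j
    using has_power_series_at_of_real[where g = "\<lambda>x. (u x)\<^sup>2", OF eUU] by (rule series_coeff_eq)
  \<comment> \<open>Compare coefficients in \<open>(U * U)' = 2 * U * U'\<close>.\<close>
  have BA: "2 * fps_nth (U * fps_deriv U) j = of_nat (Suc j) * fps_nth (U * U) (Suc j)" for j
  proof -
    have "fps_nth (fps_deriv (U * U)) j = 2 * fps_nth (U * fps_deriv U) j"
      by (simp add: mult.commute)
    thus ?thesis by (simp only: fps_deriv_nth) simp
  qed
  \<comment> \<open>The constant is written with \<open>complex_of_real 1\<close> so that it too has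
    an expansion, the series 1; its coefficients produce the case distinction on
    \<open>j = 0\<close>.\<close>
  have "has_power_series_at (\<lambda>x. \<sigma> * complex_of_real 1 * \<kappa>\<^sup>2
            + (\<sigma> * (- 2 * \<kappa> * \<omega>) * complex_of_real (v x)
            + (\<sigma> * \<omega>\<^sup>2 * complex_of_real ((v x)\<^sup>2) + \<sigma> * (- lam) * complex_of_real (u x)))) z
          (\<lambda>j. \<sigma> * complex_of_real (fps_nth 1 j) * \<kappa>\<^sup>2
            + (\<sigma> * (- 2 * \<kappa> * \<omega>) * complex_of_real (fps_nth V j)
            + (\<sigma> * \<omega>\<^sup>2 * complex_of_real (fps_nth (V * V) j)
               + \<sigma> * (- lam) * complex_of_real (fps_nth U j))))"
    by (intro has_power_series_at_add has_power_series_at_bounded_linear[OF bounded_linear_mult_right]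
          has_power_series_at_bounded_linear[OF bounded_linear_mult_left]
          has_power_series_at_of_real eU eV eVV has_fps_expansion_1)
  also have "(\<lambda>x. \<sigma> * complex_of_real 1 * \<kappa>\<^sup>2
            + (\<sigma> * (- 2 * \<kappa> * \<omega>) * complex_of_real (v x)
            + (\<sigma> * \<omega>\<^sup>2 * complex_of_real ((v x)\<^sup>2) + \<sigma> * (- lam) * complex_of_real (u x)))) = ?C"
    by (rule ext) (simp add: algebra_simps power2_eq_square)
  finally have C: "series_coeff ?C z (int j) = \<sigma> * ((if j = 0 then \<kappa>\<^sup>2 else 0)
      - 2 * \<kappa> * \<omega> * of_real (fps_nth V j) + \<omega>\<^sup>2 * of_real (fps_nth (V * V) j)
      - lam * of_real (fps_nth U j))" for j
    by (subst series_coeff_eq, assumption) (simp add: algebra_simps)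
  \<comment> \<open>Since \<open>S \<le> Suc K\<close>, the natural subtraction in \<open>m\<close>
    is exact and no index is negative.\<close>
  have ix: "int K - int S + 3 = int (m + 2)" "int K - int S + 2 = int (m + 1)"
    "int K - int S + 1 = int m"
    using \<open>S \<le> Suc K\<close> unfolding m_def by auto
  \<comment> \<open>Expressed through \<open>U * U\<close>, the \<open>A\<close> and
    \<open>B\<close> terms share the coefficient at \<open>m + 2\<close>, and
    \<open>s (s - 1) + s (m + 2) / 2 = s (s + m / 2)\<close>.\<close>
  have "complex_of_real (2 * fps_nth (U * fps_deriv U) (m + 1))
          = of_real (of_nat (m + 2) * fps_nth (U * U) (m + 2))"
    by (subst BA) simp
  hence "complex_of_real (fps_nth (U * fps_deriv U) (m + 1))
          = of_nat (m + 2) / 2 * of_real (fps_nth (U * U) (m + 2))"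
    by (simp add: mult.commute)
  thus ?thesis
    unfolding frobenius_entry_def ix A B C
    by (simp add: s_def field_simps)
qed

section \<open>Elementary symmetric polynomials and Vieta's formulas\<close>

lemma finite_multiset_index: "finite {(z, i). i < count R z}"
proof -
  have "{(z, i). i < count R z} = Sigma (set_mset R) (\<lambda>z. {..<count R z})"
    by (auto intro!: count_inI)
  thus ?thesis by simp
qed

text \<open>Forgetting the counter leaves each element once per multiplicity, so sums and products
  over the index set become \<open>sum_mset\<close> and \<open>prod_mset\<close>.\<close>

lemma image_mset_fst_multiset_index: "image_mset fst (mset_set {(z, i). i < count R z}) = R"
proof (rule multiset_eqI)
  fix z
  let ?I = "{(z, i). i < count R z}"
  have "count (image_mset fst (mset_set ?I)) z = card (fst -` {z} \<inter> ?I)"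
    using finite_multiset_index[of R] by (simp add: count_image_mset)
  also have "fst -` {z} \<inter> ?I = Pair z ` {..<count R z}"
    by auto
  also have "card \<dots> = count R z"
    by (simp add: card_image inj_on_def)
  finally show "count (image_mset fst (mset_set ?I)) z = count R z" .
qed

lemma elem_sym_1: "elem_sym 1 R = sum_mset R"
proof -
  let ?I = "{(z, i). i < count R z}"
  have "{J. J \<subseteq> ?I \<and> card J = 1} = (\<lambda>p. {p}) ` ?I"
    by (auto simp: card_1_singleton_iff)
  hence "elem_sym 1 R = (\<Sum>p\<in>?I. fst p)"
    unfolding elem_sym_def by (simp add: sum.reindex case_prod_beta)
  thus ?thesis
    by (simp add: sum_unfold_sum_mset image_mset_fst_multiset_index)
qed

text \<open>The index set is finite with \<open>size R\<close> elements, so it is its own only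
  subset of that size.\<close>

lemma elem_sym_size: "elem_sym (size R) R = prod_mset R"
proof -
  let ?I = "{(z, i). i < count R z}"
  have card: "card ?I = size R"
    using arg_cong[OF image_mset_fst_multiset_index[of R], of size] by simp
  have "{J. J \<subseteq> ?I \<and> card J = size R} = {?I}"
    using card_subset_eq[OF finite_multiset_index[of R]] card by auto
  hence "elem_sym (size R) R = (\<Prod>p\<in>?I. fst p)"
    unfolding elem_sym_def by (simp add: case_prod_beta)
  thus ?thesis
    by (simp add: prod_unfold_prod_mset image_mset_fst_multiset_index)
qed

text \<open>A complex polynomial is determined by its values, which gives the uniqueness that
  \<open>THE\<close> requires.\<close>

lemma poly_of_fun_eq: "(\<And>lam. D lam = poly p lam) \<Longrightarrow> poly_of_fun D = p"
  unfolding poly_of_fun_def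
  by (rule the_equality) (auto simp: poly_eq_poly_eq_iff[symmetric] fun_eq_iff)

lemma elem_sym_proots_linear:
  assumes "a \<noteq> 0"
  shows "elem_sym 1 (proots [:b, a:]) = - b / a"
proof -
  have "[:b, a:] = Polynomial.smult a [:b / a, 1:]"
    using assms by simp
  hence "proots [:b, a:] = {#- (b / a)#}"
    using assms by (metis proots_smult proots_linear_factor)
  thus ?thesis by (simp only: elem_sym_1) simp
qed

text \<open>Over the complex numbers there are two roots with multiplicity; expand
  \<open>a (X - x) (X - y)\<close> and compare coefficients.\<close>

lemma elem_sym_proots_quadratic:
  assumes "a \<noteq> 0"
  shows "elem_sym 1 (proots [:c, b, a:]) = - b / a"
    and "elem_sym 2 (proots [:c, b, a:]) = c / a"
proof -
  let ?p = "[:c, b, a:]"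
  have size: "size (proots ?p) = 2"
    using assms by (simp add: size_proots_complex)
  then obtain x y where xy: "proots ?p = {#x, y#}"
    by (metis numeral_2_eq_2 One_nat_def size_1_singleton_mset size_mset_SucE add_mset_add_single union_commute)
  have "Polynomial.smult a ([:- x, 1:] * [:- y, 1:]) = ?p"
    using complex_poly_decompose_multiset[of ?p] assms by (simp add: xy)
  hence b: "b = - a * (x + y)" and c: "c = a * (x * y)"
    by (auto simp: algebra_simps)
  have "elem_sym 1 (proots ?p) = x + y" "elem_sym 2 (proots ?p) = x * y"
    using elem_sym_size[of "proots ?p"] unfolding size elem_sym_1 by (simp_all add: xy)
  thus "elem_sym 1 (proots ?p) = - b / a" "elem_sym 2 (proots ?p) = c / a"
    using assms by (simp_all add: b c)
qed

section \<open>Small determinants and low-order Taylor coefficients\<close>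

lemma leading_minor_1: "leading_minor M 1 = M 1 1"
  unfolding leading_minor_def by (subst det_single) auto

lemma leading_minor_2: "leading_minor M 2 = M 1 1 * M 2 2 - M 1 2 * M 2 1"
proof -
  let ?A = "Matrix.mat 2 2 (\<lambda>(i, j). M (Suc i) (Suc j))"
  have "det ?A = (\<Sum>j<2. ?A $$ (0, j) * cofactor ?A 0 j)"
    by (rule laplace_expansion_row) auto
  also have "\<dots> = M 1 1 * M 2 2 - M 1 2 * M 2 1"
    by (simp add: numeral_2_eq_2 cofactor_def det_single mat_delete_def)
  finally show ?thesis
    unfolding leading_minor_def .
qed

lemma fps_nth_taylor_fps_low:
  "fps_nth (taylor_fps g z) 0 = g z"
  "fps_nth (taylor_fps g z) (Suc 0) = deriv g z"
  "fps_nth (taylor_fps g z) 2 = (deriv ^^ 2) g z / 2"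
  by (simp_all add: taylor_fps_def)

text \<open>At index 3 the square also contains a multiple of \<open>g z\<close> times the third
  derivative; the condition \<open>g z = 0\<close> removes it.\<close>

lemma fps_nth_taylor_fps_square_low:
  "fps_nth (taylor_fps g z * taylor_fps g z) 0 = (g z)\<^sup>2"
  "fps_nth (taylor_fps g z * taylor_fps g z) (Suc 0) = 2 * g z * deriv g z"
  "fps_nth (taylor_fps g z * taylor_fps g z) 2 = (deriv g z)\<^sup>2 + g z * (deriv ^^ 2) g z"
  "g z = 0 \<Longrightarrow> fps_nth (taylor_fps g z * taylor_fps g z) (Suc (Suc (Suc 0)))
     = deriv g z * (deriv ^^ 2) g z"
  by (simp_all add: fps_mult_nth numeral_2_eq_2 taylor_fps_def power2_eq_square)

section \<open>The common equation at orders one and two\<close>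

context
  fixes u v :: "real \<Rightarrow> real" and z :: real and \<sigma> \<kappa> \<omega> :: complex
    and M :: "complex \<Rightarrow> complex \<Rightarrow> nat \<Rightarrow> nat \<Rightarrow> complex"
  assumes u: "real_analytic_at u z" and v: "real_analytic_at v z"
    and u0: "u z = 0" and u1: "deriv u z \<noteq> 0"
  defines "M \<equiv> \<lambda>\<rho> lam. frobenius_entry (\<lambda>x. of_real ((u x)\<^sup>2)) (\<lambda>x. of_real (u x * deriv u x))
           (\<lambda>x. \<sigma> * ((\<kappa> - \<omega> * of_real (v x))\<^sup>2 - lam * of_real (u x))) z \<rho>"
begin

text \<open>Here \<open>s = - 1 / 2\<close> and \<open>m = 1\<close>, so \<open>s + m / 2\<close> is
  zero and the single entry is the first coefficient of \<open>C\<close>, linear in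
  \<open>lam\<close>. The sign \<sigma> cancels in its root.\<close>

lemma elem_sym_order_1:
  assumes "\<sigma> \<noteq> 0"
  shows "elem_sym 1 (proots (poly_of_fun (\<lambda>lam. leading_minor (M (- 1 / 2) lam) 1)))
       = - 2 * (\<kappa> - \<omega> * of_real (v z)) * \<omega> * of_real (deriv v z) / of_real (deriv u z)"
proof -
  have "leading_minor (M (- 1 / 2) lam) 1
      = poly [:- 2 * \<sigma> * (\<kappa> - \<omega> * of_real (v z)) * \<omega> * of_real (deriv v z),
               - \<sigma> * of_real (deriv u z):] lam" for lam
    unfolding leading_minor_1 M_def
    by (subst frobenius_entry_eq[OF u v])
       (simp_all add: fps_nth_taylor_fps_low fps_nth_taylor_fps_square_low u0 algebra_simps
          power2_eq_square)
  hence p: "poly_of_fun (\<lambda>lam. leading_minor (M (- 1 / 2) lam) 1)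
      = [:- 2 * \<sigma> * (\<kappa> - \<omega> * of_real (v z)) * \<omega> * of_real (deriv v z),
               - \<sigma> * of_real (deriv u z):]"
    by (rule poly_of_fun_eq)
  have "- \<sigma> * of_real (deriv u z) \<noteq> 0"
    using assms u1 by simp
  with assms show ?thesis
    unfolding p by (subst elem_sym_proots_linear) (simp_all add: field_simps)
qed

text \<open>The hypothesis on \<kappa> says that -1 solves the indicial equation
  \<open>u'(z)^2 \<rho>^2 + \<sigma> (\<kappa> - \<omega> v(z))^2 = 0\<close>. The value -\<tau> is
  the zero of \<open>M (- 1) lam 2 2\<close> in \<open>lam\<close>.\<close>

lemma elem_sym_order_2:
  assumes \<sigma>: "\<sigma>\<^sup>2 = 1" and \<kappa>: "\<sigma> * (\<kappa> - \<omega> * of_real (v z))\<^sup>2 = - (of_real (deriv u z))\<^sup>2"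
  defines "R \<equiv> proots (poly_of_fun (\<lambda>lam. leading_minor (M (- 1) lam) 2))"
    and "\<tau> \<equiv> 2 * (\<kappa> - \<omega> * of_real (v z)) * \<omega> * of_real (deriv v z) / of_real (deriv u z)"
  shows "elem_sym 1 R = \<sigma> * of_real ((deriv ^^ 2) u z) - 2 * \<tau>"
    and "elem_sym 2 R = 3 / 4 * \<tau>\<^sup>2 - \<sigma> * of_real ((deriv ^^ 2) u z) * \<tau> / 2
           - \<sigma> * (\<kappa> - \<omega> * of_real (v z)) * \<omega> * of_real ((deriv ^^ 2) v z)"
proof -
  define e p1 p2 q1 q2 where "e = \<kappa> - \<omega> * of_real (v z)"
    and "p1 = complex_of_real (deriv u z)" and "p2 = complex_of_real ((deriv ^^ 2) u z)"
    and "q1 = complex_of_real (deriv v z)" and "q2 = complex_of_real ((deriv ^^ 2) v z)"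
  note abbr = e_def p1_def p2_def q1_def q2_def
  have p1: "p1 \<noteq> 0"
    using u1 by (simp add: p1_def)
  have \<tau>: "2 * e * \<omega> * q1 = \<tau> * p1"
    using p1 by (simp add: \<tau>_def abbr)
  \<comment> \<open>With \<open>s = - 1\<close> and \<open>m = 1\<close> the factor
    \<open>s (s + m / 2)\<close> is 1/2; this is the only entry at order two to which
    \<open>A\<close> and \<open>B\<close> contribute.\<close>
  have M11: "M (- 1) lam 1 1 = p1 * p2 / 2 - \<sigma> * p1 * (lam + \<tau>)" for lam
  proof -
    have "M (- 1) lam 1 1 = p1 * p2 / 2 + \<sigma> * (- (2 * e * \<omega> * q1) - lam * p1)"
      unfolding M_def by (subst frobenius_entry_eq[OF u v])
       (simp_all add: fps_nth_taylor_fps_low fps_nth_taylor_fps_square_low u0 algebra_simps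
          power2_eq_square abbr)
    thus ?thesis unfolding \<tau> by (simp add: algebra_simps)
  qed
  have M22: "M (- 1) lam 2 2 = - \<sigma> * p1 * (lam + \<tau>)" for lam
  proof -
    have "M (- 1) lam 2 2 = \<sigma> * (- (2 * e * \<omega> * q1) - lam * p1)"
      unfolding M_def by (subst frobenius_entry_eq[OF u v])
       (simp_all add: fps_nth_taylor_fps_low fps_nth_taylor_fps_square_low u0 algebra_simps
          power2_eq_square abbr)
    thus ?thesis unfolding \<tau> by (simp add: algebra_simps)
  qed
  \<comment> \<open>With \<open>s = 0\<close> only the constant term of \<open>C\<close> remains,
    and the indicial relation turns it into \<open>- p1^2\<close>.\<close>
  have M12: "M (- 1) lam 1 2 = - p1\<^sup>2" for lam
  proof -
    have "M (- 1) lam 1 2 = \<sigma> * e\<^sup>2"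
      unfolding M_def by (subst frobenius_entry_eq[OF u v])
       (simp_all add: fps_nth_taylor_fps_low fps_nth_taylor_fps_square_low u0 algebra_simps
          power2_eq_square abbr)
    thus ?thesis using \<kappa> by (simp add: abbr)
  qed
  have M21: "M (- 1) lam 2 1 = \<sigma> * (\<omega>\<^sup>2 * q1\<^sup>2 - e * \<omega> * q2 - lam * p2 / 2)" for lam
    unfolding M_def by (subst frobenius_entry_eq[OF u v])
       (simp_all add: fps_nth_taylor_fps_low fps_nth_taylor_fps_square_low u0 algebra_simps
          power2_eq_square abbr)
  \<comment> \<open>Squaring the relation for \<tau> and replacing \<open>\<sigma> * e^2\<close> by
    \<open>- p1^2\<close> eliminates \<open>\<omega>^2 * q1^2\<close> in favour of
    \<open>\<tau>^2\<close>.\<close>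
  have "4 * (\<sigma> * e\<^sup>2) * \<omega>\<^sup>2 * q1\<^sup>2 = \<sigma> * (2 * e * \<omega> * q1)\<^sup>2"
    by (simp add: algebra_simps power2_eq_square)
  also have "\<dots> = \<sigma> * \<tau>\<^sup>2 * p1\<^sup>2"
    unfolding \<tau> by (simp add: power_mult_distrib)
  finally have "- 4 * \<omega>\<^sup>2 * q1\<^sup>2 * p1\<^sup>2 = \<sigma> * \<tau>\<^sup>2 * p1\<^sup>2"
    using \<kappa> by (simp add: abbr mult_ac)
  hence *: "- 4 * \<omega>\<^sup>2 * q1\<^sup>2 = \<sigma> * \<tau>\<^sup>2"
    using p1 by (simp only: mult_cancel_right) simp
  have "\<sigma> * (\<omega>\<^sup>2 * q1\<^sup>2) = - (\<sigma> * (- 4 * \<omega>\<^sup>2 * q1\<^sup>2)) / 4"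
    by simp
  also have "\<dots> = - (\<sigma>\<^sup>2 * \<tau>\<^sup>2) / 4"
    unfolding * by (simp add: power2_eq_square)
  finally have q1: "\<sigma> * (\<omega>\<^sup>2 * q1\<^sup>2) = - \<tau>\<^sup>2 / 4"
    using \<sigma> by simp
  \<comment> \<open>These are the coefficients of the determinant divided by \<open>p1^2\<close>.
    The diagonal product gives \<open>\<tau>^2\<close> and \<open>M21\<close> takes away a quarter;
    \<open>M11\<close> and \<open>M21\<close> each supply half of \<open>\<sigma> * p2\<close> in
    \<open>?c1\<close>.\<close>
  let ?c0 = "3 / 4 * \<tau>\<^sup>2 - \<sigma> * p2 * \<tau> / 2 - \<sigma> * e * \<omega> * q2"
  let ?c1 = "2 * \<tau> - \<sigma> * p2"
  have "leading_minor (M (- 1) lam) 2 = poly [:p1\<^sup>2 * ?c0, p1\<^sup>2 * ?c1, p1\<^sup>2:] lam" for lam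
  proof -
    have "leading_minor (M (- 1) lam) 2
        = p1\<^sup>2 * (\<sigma>\<^sup>2 * (lam + \<tau>)\<^sup>2 - \<sigma> * p2 * (lam + \<tau>) / 2
                  + \<sigma> * (\<omega>\<^sup>2 * q1\<^sup>2) - \<sigma> * e * \<omega> * q2 - \<sigma> * lam * p2 / 2)"
      unfolding leading_minor_2 M11 M12 M21 M22 by (simp add: field_simps power2_eq_square)
    also have "\<dots> = poly [:p1\<^sup>2 * ?c0, p1\<^sup>2 * ?c1, p1\<^sup>2:] lam"
      unfolding q1 \<sigma> by (simp add: field_simps power2_eq_square)
    finally show ?thesis .
  qed
  hence R: "R = proots [:p1\<^sup>2 * ?c0, p1\<^sup>2 * ?c1, p1\<^sup>2:]"
    unfolding R_def by (subst poly_of_fun_eq) auto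
  from p1 have "p1\<^sup>2 \<noteq> 0"
    by simp
  hence "elem_sym 1 R = - ?c1" "elem_sym 2 R = ?c0"
    unfolding R elem_sym_proots_quadratic[OF \<open>p1\<^sup>2 \<noteq> 0\<close>] by simp_all
  thus "elem_sym 1 R = \<sigma> * of_real ((deriv ^^ 2) u z) - 2 * \<tau>"
    and "elem_sym 2 R = 3 / 4 * \<tau>\<^sup>2 - \<sigma> * of_real ((deriv ^^ 2) u z) * \<tau> / 2
           - \<sigma> * (\<kappa> - \<omega> * of_real (v z)) * \<omega> * of_real ((deriv ^^ 2) v z)"
    by (simp_all add: abbr)
qed

end

section \<open>Specialisation to the horizon and the axis\<close>

theorem mainTheorem4:
  fixes G :: carter_spacetime
  assumes "real_analytic_at (f\<^sub>1 G) (r\<^sub>h G)"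
    and "real_analytic_at (f\<^sub>2 G) (r\<^sub>h G)"
    and "real_analytic_at (y\<^sub>1 G) (x\<^sub>0 G)"
    and "real_analytic_at (y\<^sub>2 G) (x\<^sub>0 G)"
    and "f\<^sub>1 G (r\<^sub>h G) = 0"
    and "f\<^sub>2 G (r\<^sub>h G) \<noteq> 0"
    and "hawking_temp G > 0"
    and "y\<^sub>1 G (x\<^sub>0 G) = 0"
    and "y\<^sub>2 G (x\<^sub>0 G) = 0"
    and "deriv (y\<^sub>1 G) (x\<^sub>0 G) \<noteq> 0"
    and "rot G \<noteq> 0"
    and "w_n G 1 + k_n G 1 * of_real (Omega_H G) \<noteq> 0"
  shows
    "of_real (deriv (f\<^sub>1 G) (r\<^sub>h G))
        = 2 * \<i> * of_real (rot G) * w_n G 1 / of_real (Omega_H G)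
     \<and> of_real (deriv (f\<^sub>2 G) (r\<^sub>h G))
        = \<i> * E_rad G 1 1 / (w_n G 1 + k_n G 1 * of_real (Omega_H G))
     \<and> of_real (deriv (y\<^sub>1 G) (x\<^sub>0 G)) = 2 * k_n G 1
     \<and> of_real (deriv (y\<^sub>2 G) (x\<^sub>0 G))
        = - E_ang G 1 1 / (w_n G 1 + k_n G 1 * of_real (Omega_H G))
     \<and> of_real ((deriv ^^ 2) (f\<^sub>1 G) (r\<^sub>h G)) = E_rad G 2 1 - 8 * E_rad G 1 1
     \<and> of_real ((deriv ^^ 2) (y\<^sub>1 G) (x\<^sub>0 G)) = 8 * E_ang G 1 1 - E_ang G 2 1
     \<and> of_real ((deriv ^^ 2) (f\<^sub>2 G) (r\<^sub>h G))
        = of_real (Omega_H G)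
            / (4 * of_real (rot G) * w_n G 1 * (w_n G 1 + k_n G 1 * of_real (Omega_H G)))
          * (E_rad G 2 2 - 2 * E_rad G 2 1 * E_rad G 1 1 + 4 * (E_rad G 1 1)\<^sup>2)
     \<and> of_real ((deriv ^^ 2) (y\<^sub>2 G) (x\<^sub>0 G))
        = 1 / (4 * k_n G 1 * (w_n G 1 + k_n G 1 * of_real (Omega_H G)))
          * (E_ang G 2 2 - 2 * E_ang G 2 1 * E_ang G 1 1 + 4 * (E_ang G 1 1)\<^sup>2)"
proof -
  define f11 f12 f21 f22 where "f11 = complex_of_real (deriv (f\<^sub>1 G) (r\<^sub>h G))"
    and "f12 = complex_of_real ((deriv ^^ 2) (f\<^sub>1 G) (r\<^sub>h G))"
    and "f21 = complex_of_real (deriv (f\<^sub>2 G) (r\<^sub>h G))"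
    and "f22 = complex_of_real ((deriv ^^ 2) (f\<^sub>2 G) (r\<^sub>h G))"
  define y11 y12 y21 y22 where "y11 = complex_of_real (deriv (y\<^sub>1 G) (x\<^sub>0 G))"
    and "y12 = complex_of_real ((deriv ^^ 2) (y\<^sub>1 G) (x\<^sub>0 G))"
    and "y21 = complex_of_real (deriv (y\<^sub>2 G) (x\<^sub>0 G))"
    and "y22 = complex_of_real ((deriv ^^ 2) (y\<^sub>2 G) (x\<^sub>0 G))"
  define f20 a where "f20 = complex_of_real (f\<^sub>2 G (r\<^sub>h G))" and "a = complex_of_real (rot G)"
  note abbr = f11_def f12_def f21_def f22_def y11_def y12_def y21_def y22_def f20_def a_def
  have f1': "deriv (f\<^sub>1 G) (r\<^sub>h G) \<noteq> 0"
    using assms(7) by (auto simp: hawking_temp_def)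
  have nz: "f11 \<noteq> 0" "f20 \<noteq> 0" "y11 \<noteq> 0" "a \<noteq> 0"
    using f1' assms(6,10,11) by (simp_all add: abbr)
  have w: "w_n G n = - \<i> * of_nat n * f11 / (2 * f20)" for n
    using nz by (simp add: w_n_def hawking_temp_def abbr field_simps)
  have k: "k_n G n = of_nat n * y11 / 2" for n
    by (simp add: k_n_def abbr)
  have Om: "of_real (Omega_H G) = a / f20"
    by (simp add: Omega_H_def abbr)
  have \<omega>2: "omega_n G 2 = 2 * omega_n G 1"
    by (simp add: omega_n_def w k field_simps)
  have \<omega>1: "w_n G 1 + k_n G 1 * of_real (Omega_H G) = omega_n G 1" "omega_n G 1 \<noteq> 0"
    using assms(12) by (simp_all add: omega_n_def)
  \<comment> \<open>The left side is \<open>- f20 * w_n G n\<close>, as the two contributions of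
    \<open>k_n\<close> cancel. For \<open>n = 2\<close> its square is \<open>- f11^2\<close>, which
    is the indicial hypothesis.\<close>
  have e: "a * k_n G n - omega_n G n * f20 = \<i> * of_nat n * f11 / 2" for n
    using nz by (simp add: omega_n_def w k Om field_simps)
  have "rho_rad G (omega_n G n) (k_n G n) = - \<i> * w_n G n / (4 * of_real pi * of_real (hawking_temp G))" for n
    by (simp add: rho_rad_def omega_n_def)
  hence rr: "rho_rad G (omega_n G n) (k_n G n) = - of_nat n / 2" for n
    using assms(7) by (simp add: w_n_def field_simps)
  have ra: "rho_ang G (k_n G n) = - of_nat n / 2" for n
    using nz by (simp add: rho_ang_def k_n_def abbr)
  \<comment> \<open>Both sectors are cast into the common form; the factor 1 here and -1 in
    \<open>Ma\<close> is \<sigma>.\<close>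
  have Mr: "M_rad G (omega_n G n) (k_n G n) lam =
      frobenius_entry (\<lambda>x. of_real ((f\<^sub>1 G x)\<^sup>2)) (\<lambda>x. of_real (f\<^sub>1 G x * deriv (f\<^sub>1 G) x))
        (\<lambda>x. 1 * ((a * k_n G n - omega_n G n * of_real (f\<^sub>2 G x))\<^sup>2 - lam * of_real (f\<^sub>1 G x)))
        (r\<^sub>h G) (- of_nat n / 2)" for n lam
    unfolding M_rad_def rr A_rad_def[abs_def] B_rad_def[abs_def] C_rad_def[abs_def] abbr by simp
  have Ma: "M_ang G (omega_n G n) (k_n G n) lam =
      frobenius_entry (\<lambda>x. of_real ((y\<^sub>1 G x)\<^sup>2)) (\<lambda>x. of_real (y\<^sub>1 G x * deriv (y\<^sub>1 G) x))
        (\<lambda>x. - 1 * ((k_n G n - omega_n G n * of_real (y\<^sub>2 G x))\<^sup>2 - lam * of_real (y\<^sub>1 G x)))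
        (x\<^sub>0 G) (- of_nat n / 2)" for n lam
    unfolding M_ang_def ra A_ang_def[abs_def] B_ang_def[abs_def] C_ang_def[abs_def] by simp
  note rad1 = elem_sym_order_1[OF assms(1,2,5) f1', where \<sigma> = 1 and \<kappa> = "a * k_n G 1" and \<omega> = "omega_n G 1"]
  note rad2 = elem_sym_order_2[OF assms(1,2,5) f1', where \<sigma> = 1 and \<kappa> = "a * k_n G 2" and \<omega> = "omega_n G 2"]
  note ang1 = elem_sym_order_1[OF assms(3,4,8,10), where \<sigma> = "- 1" and \<kappa> = "k_n G 1" and \<omega> = "omega_n G 1"]
  note ang2 = elem_sym_order_2[OF assms(3,4,8,10), where \<sigma> = "- 1" and \<kappa> = "k_n G 2" and \<omega> = "omega_n G 2"]
  have r11: "E_rad G 1 1 = - \<i> * omega_n G 1 * f21"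
    using rad1[folded abbr, unfolded e] nz unfolding E_rad_def roots_rad_def Mr by (simp flip: abbr)
  have r2: "E_rad G 2 1 = f12 - 4 * \<i> * omega_n G 2 * f21"
    "E_rad G 2 2 = 3 / 4 * (2 * \<i> * omega_n G 2 * f21)\<^sup>2 - \<i> * f12 * omega_n G 2 * f21
       - \<i> * f11 * omega_n G 2 * f22"
    using rad2 nz e[of 2] unfolding E_rad_def roots_rad_def Mr
    by (simp_all add: power_mult_distrib flip: abbr)
  \<comment> \<open>As \<open>y\<^sub>2\<close> vanishes on the axis,
    \<open>\<kappa> - \<omega> * y\<^sub>2\<close> reduces there to \<open>k_n G n\<close>, that is
    \<open>n * y11 / 2\<close>.\<close>
  have a11: "E_ang G 1 1 = - omega_n G 1 * y21"
    using ang1[unfolded k] nz assms(9) unfolding E_ang_def roots_ang_def Ma unfolding k by (simp flip: abbr)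
  have a2: "E_ang G 2 1 = - y12 - 4 * omega_n G 2 * y21"
    "E_ang G 2 2 = 3 / 4 * (2 * omega_n G 2 * y21)\<^sup>2 + y12 * omega_n G 2 * y21
       + y11 * omega_n G 2 * y22"
    using ang2 nz k[of 2] assms(9) unfolding E_ang_def roots_ang_def Ma
    by (simp_all add: power_mult_distrib flip: abbr)
  \<comment> \<open>Let \<open>E1\<close> be the order-one sum. Doubling the frequency gives
    \<open>\<tau> = - 4 * E1\<close> in both sectors, so the order-two sum is
    \<open>\<sigma> u'' + 8 * E1\<close>. In the combination for the second derivative of
    \<open>v\<close> the squares cancel as 12 - 16 + 4 = 0, and so do the terms with
    \<open>u''\<close>.\<close>
  show ?thesis
    unfolding \<omega>1 unfolding Om r11 r2 a11 a2 \<omega>2 w k abbr[symmetric]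
    using nz \<omega>1(2) by (simp add: field_simps power2_eq_square)
qed

end
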